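(* For every $n\ge1$, the number of irreducible supermodular functions $f\colon 2^{[n]}\to\mathbb{R}$, up to equivalence, is at most $\binom{n^22^n}{2^n}$.
   Context: A function $f\colon 2^{[n]}\to\mathbb{R}$ is supermodular if $f(I\cap J)+f(I\cup J)\ge f(I)+f(J)$ for all $I,J\subseteq[n]$, and modular if equality always holds. Two supermodular functions are equivalent if they differ by a modular function. A supermodular function $f$ is irreducible if it is not modular and whenever $f=g_1+g_2$ with $g_1,g_2$ supermodular, each $g_i$ is equivalent to $c_if$ for some $c_i\ge0$. Irreducible functions are counted up to equivalence and positive scaling ($f$ and $g$ identified if $g-cf$ is modular for some $c>0$). *)

theory Defs
  imports Complex_Main "HOL-Library.FuncSet"
begin

text \<open>
  A function on the subsets of \<open>{1..n}\<close> is a HOL function of type \<open>nat set \<Rightarrow> real\<close>. The predicates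
  below look only at its values on \<open>Pow {1..n}\<close>; the functions that are counted are in addition
  required to be extensional, so that they correspond one-to-one to functions on \<open>Pow {1..n}\<close>.
\<close>

definition supermodular :: "nat \<Rightarrow> (nat set \<Rightarrow> real) \<Rightarrow> bool" where
  "supermodular n f \<longleftrightarrow>
     (\<forall>I\<in>Pow {1..n}. \<forall>J\<in>Pow {1..n}. f (I \<inter> J) + f (I \<union> J) \<ge> f I + f J)"

definition modular :: "nat \<Rightarrow> (nat set \<Rightarrow> real) \<Rightarrow> bool" where
  "modular n f \<longleftrightarrow>
     (\<forall>I\<in>Pow {1..n}. \<forall>J\<in>Pow {1..n}. f (I \<inter> J) + f (I \<union> J) = f I + f J)"

definition equivalent :: "nat \<Rightarrow> (nat set \<Rightarrow> real) \<Rightarrow> (nat set \<Rightarrow> real) \<Rightarrow> bool" where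
  "equivalent n f g \<longleftrightarrow> modular n (\<lambda>I. f I - g I)"

definition irreducible_supermodular :: "nat \<Rightarrow> (nat set \<Rightarrow> real) \<Rightarrow> bool" where
  "irreducible_supermodular n f \<longleftrightarrow>
     supermodular n f \<and> \<not> modular n f \<and>
     (\<forall>g1 g2. supermodular n g1 \<longrightarrow> supermodular n g2 \<longrightarrow>
        (\<forall>I\<in>Pow {1..n}. f I = g1 I + g2 I) \<longrightarrow>
        (\<exists>c1\<ge>0. equivalent n g1 (\<lambda>I. c1 * f I)) \<and>
        (\<exists>c2\<ge>0. equivalent n g2 (\<lambda>I. c2 * f I)))"

definition irreducibles :: "nat \<Rightarrow> (nat set \<Rightarrow> real) set" where
  "irreducibles n = {f \<in> Pow {1..n} \<rightarrow>\<^sub>E UNIV. irreducible_supermodular n f}"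

definition same_ray :: "nat \<Rightarrow> ((nat set \<Rightarrow> real) \<times> (nat set \<Rightarrow> real)) set" where
  "same_ray n = {(f, g). f \<in> irreducibles n \<and> g \<in> irreducibles n \<and>
                         (\<exists>c>0. equivalent n g (\<lambda>I. c * f I))}"

lemma equiv_same_ray: "equiv (irreducibles n) (same_ray n)"
proof (rule equivI)
  show "same_ray n \<subseteq> irreducibles n \<times> irreducibles n"
    by (auto simp: same_ray_def)
  show "refl_on (irreducibles n) (same_ray n)"
    by (auto simp: refl_on_def same_ray_def equivalent_def modular_def intro!: exI[of _ 1])
  show "sym (same_ray n)"
  proof (rule symI)
    fix f g assume "(f, g) \<in> same_ray n"
    then obtain c where fg: "f \<in> irreducibles n" "g \<in> irreducibles n" and c: "c > 0"
      and m: "modular n (\<lambda>I. g I - c * f I)"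
      by (auto simp: same_ray_def equivalent_def)
    have "modular n (\<lambda>I. (- inverse c) * (g I - c * f I))"
      using m unfolding modular_def by (simp only: distrib_left [symmetric]) simp
    moreover have "(\<lambda>I. (- inverse c) * (g I - c * f I)) = (\<lambda>I. f I - inverse c * g I)"
      using c by (auto simp: algebra_simps)
    ultimately have "equivalent n f (\<lambda>I. inverse c * g I)"
      by (simp only: equivalent_def)
    with fg c show "(g, f) \<in> same_ray n"
      by (auto simp: same_ray_def intro!: exI[of _ "inverse c"])
  qed
  show "trans (same_ray n)"
  proof (rule transI)
    fix f g h assume "(f, g) \<in> same_ray n" "(g, h) \<in> same_ray n"
    then obtain c d where fh: "f \<in> irreducibles n" "h \<in> irreducibles n" and cd: "c > 0" "d > 0"
      and m: "modular n (\<lambda>I. g I - c * f I)" "modular n (\<lambda>I. h I - d * g I)"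
      by (auto simp: same_ray_def equivalent_def)
    have "modular n (\<lambda>I. d * (g I - c * f I))"
      using m(1) unfolding modular_def by (simp only: distrib_left [symmetric]) simp
    with m(2) have "modular n (\<lambda>I. (h I - d * g I) + d * (g I - c * f I))"
      unfolding modular_def by (smt (verit))
    moreover have "(\<lambda>I. (h I - d * g I) + d * (g I - c * f I)) = (\<lambda>I. h I - (d * c) * f I)"
      by (auto simp: algebra_simps)
    ultimately have "equivalent n h (\<lambda>I. (d * c) * f I)"
      by (simp only: equivalent_def)
    moreover have "d * c > 0" using cd by simp
    ultimately show "(f, h) \<in> same_ray n"
      using fh by (auto simp only: same_ray_def)
  qed
qed

end

theory Submission
  imports Defs "HOL-Library.Function_Algebras"
begin

text \<open>
  Supermodularity is equivalent to the local inequalities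
  \<open>f (S + i + j) + f S \<ge> f (S + i) + f (S + j)\<close> with \<open>i \<noteq> j\<close>, that is, to the nonnegativity of at most
  \<open>n (n - 1) 2 ^ n\<close> linear functionals. If \<open>f\<close> is irreducible and \<open>g\<close> annihilates every functional
  that is tight at \<open>f\<close>, then \<open>f \<plusminus> \<epsilon> g\<close> is supermodular for small \<open>\<epsilon>\<close>, and irreducibility makes \<open>g\<close>
  equivalent to a multiple of \<open>f\<close>. Hence a basis of the span of the tight functionals, a set of at
  most \<open>2 ^ n\<close> of them, determines the ray of \<open>f\<close>. Subsets of size at most \<open>2 ^ n\<close> are padded to
  size exactly \<open>2 ^ n\<close> with \<open>2 ^ n\<close> extra elements, and \<open>n (n - 1) 2 ^ n + 2 ^ n \<le> n\<^sup>2 2 ^ n\<close>.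
\<close>

section \<open>Counting\<close>

text \<open>A class is recovered from the value of \<open>h\<close> at any of its members, so
  \<open>F\<close> surjects onto the classes met by it. The map \<open>h\<close> may take several
  values on one class, which only makes the bound cruder.\<close>

lemma card_quotient_le:
  assumes R: "equiv A R" and F: "finite F" "h ` A \<subseteq> F"
    and inj: "\<And>x y. x \<in> A \<Longrightarrow> y \<in> A \<Longrightarrow> h x = h y \<Longrightarrow> (x, y) \<in> R"
  shows "finite (A // R) \<and> card (A // R) \<le> card F"
proof -
  have "A // R \<subseteq> (\<lambda>b. R `` {inv_into A h b}) ` F"
  proof
    fix X assume "X \<in> A // R"
    then obtain x where x: "x \<in> A" "X = R `` {x}" by (rule quotientE)
    let ?y = "inv_into A h (h x)"
    have "?y \<in> A" "h ?y = h x"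
      using x by (auto intro: inv_into_into f_inv_into_f)
    then have "(x, ?y) \<in> R" using inj x by auto
    then have "X = R `` {?y}" using x equiv_class_eq[OF R] by blast
    then show "X \<in> (\<lambda>b. R `` {inv_into A h b}) ` F"
      using x F by blast
  qed
  with F show ?thesis
    by (meson surj_card_le finite_surj)
qed

lemma card_subsets_card_le:
  assumes "finite M"
  shows "card {B. B \<subseteq> M \<and> card B \<le> k} \<le> (card M + k) choose k"
proof -
  \<comment> \<open>The left summand of the padded set gives back \<open>B\<close>, so a fixed
    initial segment as padding is already injective.\<close>
  let ?U = "M <+> {..<k}" and ?pad = "\<lambda>B. B <+> {..<k - card B}"
  have "inj_on ?pad {B. B \<subseteq> M \<and> card B \<le> k}"
    by (rule inj_onI) (auto simp: Plus_def set_eq_iff image_iff)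
  moreover have "?pad ` {B. B \<subseteq> M \<and> card B \<le> k} \<subseteq> {C. C \<subseteq> ?U \<and> card C = k}"
    using assms by (auto simp: card_Plus finite_subset)
  moreover have "finite {C. C \<subseteq> ?U \<and> card C = k}"
    using assms by simp
  ultimately have "card {B. B \<subseteq> M \<and> card B \<le> k} \<le> card {C. C \<subseteq> ?U \<and> card C = k}"
    by (rule card_inj_on_le)
  also have "\<dots> = (card M + k) choose k"
    using assms by (simp add: n_subsets card_Plus)
  finally show ?thesis .
qed

section \<open>Local inequalities\<close>

interpretation fun_vs: vector_space "\<lambda>(c::real) (v::'a \<Rightarrow> real) x. c * v x"
  by unfold_locales (auto simp: fun_eq_iff algebra_simps)

definition delta :: "'a \<Rightarrow> 'a \<Rightarrow> real" where
  "delta a = (\<lambda>x. of_bool (x = a))"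

text \<open>Functionals are encoded as coefficient vectors, so that span and independence of
  functions apply to them; the finite set \<open>A\<close> carries the coordinates that
  count.\<close>

definition pairing :: "'a set \<Rightarrow> ('a \<Rightarrow> real) \<Rightarrow> ('a \<Rightarrow> real) \<Rightarrow> real" where
  "pairing A v g = (\<Sum>x\<in>A. v x * g x)"

lemma pairing_delta: "finite A \<Longrightarrow> a \<in> A \<Longrightarrow> pairing A (delta a) g = g a"
  by (simp add: pairing_def delta_def)

lemma pairing_add_left: "pairing A (v + w) g = pairing A v g + pairing A w g"
  by (simp add: pairing_def sum.distrib algebra_simps)

lemma pairing_diff_left: "pairing A (v - w) g = pairing A v g - pairing A w g"
  by (simp add: pairing_def sum_subtractf algebra_simps)

lemma pairing_scale_left: "pairing A (\<lambda>x. c * v x) g = c * pairing A v g"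
  by (simp add: pairing_def sum_distrib_left algebra_simps)

lemma pairing_add_right: "pairing A v (\<lambda>x. g x + h x) = pairing A v g + pairing A v h"
  by (simp add: pairing_def sum.distrib algebra_simps)

lemma pairing_scale_right: "pairing A v (\<lambda>x. c * g x) = c * pairing A v g"
  by (simp add: pairing_def sum_distrib_left algebra_simps)

text \<open>The vectors annihilating \<open>g\<close> form a subspace. This lets a basis stand for
  all tight functionals.\<close>

lemma pairing_span_eq_0:
  assumes "v \<in> fun_vs.span B" "\<And>w. w \<in> B \<Longrightarrow> pairing A w g = 0"
  shows "pairing A v g = 0"
proof -
  have "fun_vs.subspace {w. pairing A w g = 0}"
    unfolding fun_vs.subspace_def
    by (auto simp: pairing_add_left pairing_scale_left) (simp add: pairing_def)
  then show ?thesis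
    using fun_vs.span_induct[OF assms(1), of "\<lambda>w. pairing A w g = 0"] assms(2) by auto
qed

text \<open>This is the mixed second difference at \<open>S\<close> in directions \<open>i\<close>
  and \<open>j\<close>. For distinct \<open>i\<close>, \<open>j\<close> it is the zero vector as
  soon as \<open>S\<close> contains one of them, so \<open>S\<close> may range over all
  subsets.\<close>

fun local_functional :: "nat set \<times> nat \<times> nat \<Rightarrow> nat set \<Rightarrow> real" where
  "local_functional (S, i, j) =
     delta S + delta (insert i (insert j S)) - delta (insert i S) - delta (insert j S)"

definition local_functionals :: "nat \<Rightarrow> (nat set \<Rightarrow> real) set" where
  "local_functionals n = local_functional ` (Pow {1..n} \<times> ({1..n} \<times> {1..n} - Id))"

lemma local_functionalsE:
  assumes "v \<in> local_functionals n"
  obtains S i j where "v = local_functional (S, i, j)"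
    "S \<subseteq> {1..n}" "i \<in> {1..n}" "j \<in> {1..n}" "i \<noteq> j"
  using assms unfolding local_functionals_def by (elim imageE) (force simp del: local_functional.simps)

lemma pairing_local_functional:
  assumes "S \<subseteq> {1..n}" "i \<in> {1..n}" "j \<in> {1..n}"
  shows "pairing (Pow {1..n}) (local_functional (S, i, j)) g =
         g S + g (insert i (insert j S)) - g (insert i S) - g (insert j S)"
  using assms by (simp add: pairing_add_left pairing_diff_left pairing_delta)

lemma finite_local_functionals: "finite (local_functionals n)"
  by (simp add: local_functionals_def)

lemma card_local_functionals: "card (local_functionals n) \<le> n * (n - 1) * 2 ^ n"
proof -
  have "{1..n} \<times> {1..n} - Id = {1..n} \<times> {1..n} - (\<lambda>i. (i, i)) ` {1..n}" by auto
  also have "card \<dots> = n * n - n"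
    by (subst card_Diff_subset) (auto simp: card_image inj_on_def)
  finally have "card (Pow {1..n} \<times> ({1..n} \<times> {1..n} - Id)) = n * (n - 1) * 2 ^ n"
    by (simp add: card_cartesian_product card_Pow diff_mult_distrib2 mult.commute)
  then show ?thesis
    unfolding local_functionals_def by (metis card_image_le finite_Diff finite_Pow_iff
        finite_SigmaI finite_atLeastAtMost)
qed

lemma local_functionals_span: "local_functionals n \<subseteq> fun_vs.span (delta ` Pow {1..n})"
proof
  fix v assume "v \<in> local_functionals n"
  then obtain S i j where "v = local_functional (S, i, j)" "S \<subseteq> {1..n}" "i \<in> {1..n}" "j \<in> {1..n}"
    by (rule local_functionalsE)
  then show "v \<in> fun_vs.span (delta ` Pow {1..n})"
    by (simp only: local_functional.simps)
      (intro fun_vs.span_diff fun_vs.span_add fun_vs.span_base imageI, auto)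
qed

text \<open>The local inequality says that the marginal gain of \<open>i\<close> does not drop when
  one element joins \<open>S\<close>. Induction extends this first to enlarging \<open>S\<close> by
  a set (\<open>single\<close>), then to the gain of a whole set (\<open>many\<close>).\<close>

lemma supermodular_if_local:
  assumes loc: "\<And>v. v \<in> local_functionals n \<Longrightarrow> pairing (Pow {1..n}) v f \<ge> 0"
  shows "supermodular n f"
proof -
  have step: "f (insert i S) + f (insert j S) \<le> f S + f (insert i (insert j S))"
    if "S \<subseteq> {1..n}" "i \<in> {1..n}" "j \<in> {1..n}" "i \<noteq> j" for S i j
  proof -
    have "local_functional (S, i, j) \<in> local_functionals n"
      using that unfolding local_functionals_def by (intro imageI) auto
    from loc[OF this] show ?thesis
      using that by (simp only: pairing_local_functional)
  qed
  have single: "f (insert i S) - f S \<le> f (insert i (S \<union> X)) - f (S \<union> X)"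
    if "finite X" "S \<union> X \<subseteq> {1..n}" "i \<in> {1..n}" "i \<notin> S \<union> X" for S X i
    using that
  proof (induction X rule: finite_induct)
    case (insert x X)
    then show ?case
      using step[of "S \<union> X" i x] by auto
  qed simp
  have many: "f (S \<union> X) - f S \<le> f (S \<union> T \<union> X) - f (S \<union> T)"
    if "finite X" "S \<union> T \<union> X \<subseteq> {1..n}" "X \<inter> (S \<union> T) = {}" for S T X
    using that
  proof (induction X rule: finite_induct)
    case (insert x X)
    have "finite T" using insert.prems finite_subset by blast
    then have "f (insert x (S \<union> X)) - f (S \<union> X) \<le> f (insert x (S \<union> X \<union> T)) - f (S \<union> X \<union> T)"
      using single[of T "S \<union> X" x] insert by auto
    moreover have "S \<union> X \<union> T = S \<union> T \<union> X" by blast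
    moreover have "f (S \<union> X) - f S \<le> f (S \<union> T \<union> X) - f (S \<union> T)"
      using insert by auto
    ultimately show ?case by simp
  qed simp
  show ?thesis
    unfolding supermodular_def
  proof (intro ballI)
    fix I J assume IJ: "I \<in> Pow {1..n}" "J \<in> Pow {1..n}"
    \<comment> \<open>Supermodularity compares the gain of \<open>J - I\<close> over
      \<open>I \<inter> J\<close> with its gain over \<open>I\<close>.\<close>
    have "finite (J - I)" using IJ finite_subset by blast
    moreover have "I \<inter> J \<union> (J - I) = J" "I \<inter> J \<union> I = I" "I \<union> (J - I) = I \<union> J"
      "(J - I) \<inter> I = {}" by auto
    ultimately show "f (I \<inter> J) + f (I \<union> J) \<ge> f I + f J"
      using many[of "J - I" "I \<inter> J" I] IJ by auto
  qed
qed

lemma pairing_local_functional_nonneg: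
  assumes "supermodular n f" "v \<in> local_functionals n"
  shows "pairing (Pow {1..n}) v f \<ge> 0"
proof -
  obtain S i j where v: "v = local_functional (S, i, j)"
    and S: "S \<subseteq> {1..n}" "i \<in> {1..n}" "j \<in> {1..n}" "i \<noteq> j"
    using assms(2) by (rule local_functionalsE)
  have "insert i S \<in> Pow {1..n}" "insert j S \<in> Pow {1..n}" using S by auto
  then have sup: "f (insert i S \<inter> insert j S) + f (insert i S \<union> insert j S)
      \<ge> f (insert i S) + f (insert j S)"
    using assms(1) unfolding supermodular_def by blast
  have un: "insert i S \<union> insert j S = insert i (insert j S)" by blast
  \<comment> \<open>If \<open>S\<close> contains \<open>i\<close> or \<open>j\<close>, both sides of
    the inequality coincide.\<close>
  consider "i \<in> S" | "j \<in> S" | "i \<notin> S" "j \<notin> S" by blast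
  then have "f (insert i S) + f (insert j S) \<le> f S + f (insert i (insert j S))"
  proof cases
    case 3
    then have "insert i S \<inter> insert j S = S" using S by auto
    then show ?thesis using sup un by simp
  qed (simp_all add: insert_absorb insert_commute)
  then show ?thesis
    unfolding v pairing_local_functional[OF S(1-3)] by linarith
qed

section \<open>Rays and tight functionals\<close>

text \<open>Any \<open>e\<close> below all ratios of \<open>a v\<close> to the absolute value of
  \<open>b v\<close>, taken where \<open>b v\<close> is nonzero, works; these ratios are finitely
  many and positive.\<close>

lemma perturbation_bound:
  fixes a b :: "'a \<Rightarrow> real"
  assumes "finite A" "\<And>v. v \<in> A \<Longrightarrow> 0 \<le> a v" "\<And>v. v \<in> A \<Longrightarrow> a v = 0 \<Longrightarrow> b v = 0"
  shows "\<exists>e>0. \<forall>v\<in>A. e * \<bar>b v\<bar> \<le> a v"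
  using assms
proof (induction A rule: finite_induct)
  case (insert x A)
  then obtain e where e: "e > 0" "\<forall>v\<in>A. e * \<bar>b v\<bar> \<le> a v" by auto
  show ?case
  proof (cases "b x = 0")
    case True
    then show ?thesis using e insert by auto
  next
    case False
    then have ax: "a x > 0" using insert.prems by force
    define d where "d = min e (a x / \<bar>b x\<bar>)"
    have "d > 0" using e ax False by (simp add: d_def)
    moreover have "d * \<bar>b x\<bar> \<le> (a x / \<bar>b x\<bar>) * \<bar>b x\<bar>"
      by (rule mult_right_mono) (auto simp: d_def)
    moreover have "d * \<bar>b v\<bar> \<le> a v" if "v \<in> A" for v
    proof -
      have "d * \<bar>b v\<bar> \<le> e * \<bar>b v\<bar>" by (rule mult_right_mono) (auto simp: d_def)
      then show ?thesis using e that by force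
    qed
    ultimately show ?thesis using False by auto
  qed
qed (auto intro: exI[of _ 1])

definition tight :: "nat \<Rightarrow> (nat set \<Rightarrow> real) \<Rightarrow> (nat set \<Rightarrow> real) set" where
  "tight n f = {v \<in> local_functionals n. pairing (Pow {1..n}) v f = 0}"

text \<open>For small \<open>e\<close>, \<open>f\<close> is the sum of the supermodular functions
  \<open>(f + e g)/2\<close> and \<open>(f - e g)/2\<close>; irreducibility applied to the first
  determines \<open>g\<close> up to a modular function.\<close>

lemma equivalent_if_tight:
  assumes f: "irreducible_supermodular n f"
    and g: "\<And>v. v \<in> tight n f \<Longrightarrow> pairing (Pow {1..n}) v g = 0"
  shows "\<exists>c. equivalent n g (\<lambda>I. c * f I)"
proof -
  let ?p = "pairing (Pow {1..n})"
  have sup: "supermodular n f" using f by (simp add: irreducible_supermodular_def)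
  obtain e where e: "e > 0" "\<forall>v\<in>local_functionals n. e * \<bar>?p v g\<bar> \<le> ?p v f"
    using perturbation_bound[of "local_functionals n" "\<lambda>v. ?p v f" "\<lambda>v. ?p v g"]
      finite_local_functionals pairing_local_functional_nonneg[OF sup] g
    by (auto simp: tight_def)
  have pert: "supermodular n (\<lambda>I. (1/2) * f I + s * e / 2 * g I)" if "\<bar>s\<bar> = 1" for s
  proof (rule supermodular_if_local)
    fix v assume v: "v \<in> local_functionals n"
    have "\<bar>s * e * ?p v g\<bar> \<le> ?p v f"
      using e v that by (simp add: abs_mult)
    then show "?p v (\<lambda>I. (1/2) * f I + s * e / 2 * g I) \<ge> 0"
      unfolding pairing_add_right pairing_scale_right by (simp add: abs_le_iff)
  qed
  have "\<forall>I\<in>Pow {1..n}. f I = ((1/2) * f I + 1 * e / 2 * g I) + ((1/2) * f I + (-1) * e / 2 * g I)"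
    by simp
  then obtain c where c: "equivalent n (\<lambda>I. (1/2) * f I + 1 * e / 2 * g I) (\<lambda>I. c * f I)"
    using f pert[of 1] pert[of "-1"] unfolding irreducible_supermodular_def by fastforce
  let ?h = "\<lambda>I. (1/2) * f I + 1 * e / 2 * g I - c * f I"
  \<comment> \<open>The factor comes from solving \<open>f/2 + e g/2 = c f\<close> for
    \<open>g\<close>.\<close>
  have "(\<lambda>I. g I - (2 * c - 1) / e * f I) = (\<lambda>I. 2 / e * ?h I)"
    using e by (auto simp: field_simps)
  moreover have "modular n (\<lambda>I. 2 / e * ?h I)"
    using c unfolding equivalent_def modular_def by (simp only: distrib_left [symmetric]) simp
  ultimately have "equivalent n g (\<lambda>I. (2 * c - 1) / e * f I)"
    by (simp only: equivalent_def)
  then show ?thesis by blast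
qed

text \<open>The supermodular excess of \<open>g\<close> is \<open>c\<close> times that of
  \<open>f\<close>. If \<open>c\<close> were at most 0, it would be both nonnegative and
  nonpositive, making \<open>g\<close> modular.\<close>

lemma pos_multiple:
  assumes "supermodular n f" "supermodular n g" "\<not> modular n g"
    and "equivalent n g (\<lambda>I. c * f I)"
  shows "c > 0"
proof (rule ccontr)
  assume "\<not> c > 0"
  have "modular n g"
    unfolding modular_def
  proof (intro ballI)
    fix I J assume IJ: "I \<in> Pow {1..n}" "J \<in> Pow {1..n}"
    let ?U = "I \<union> J" and ?M = "I \<inter> J"
    have f: "f ?M + f ?U \<ge> f I + f J" and g: "g ?M + g ?U \<ge> g I + g J"
      using assms(1,2) IJ unfolding supermodular_def by blast+
    have "(g ?M - c * f ?M) + (g ?U - c * f ?U) = (g I - c * f I) + (g J - c * f J)"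
      using assms(4) IJ unfolding equivalent_def modular_def by blast
    then have "g ?M + g ?U - (g I + g J) = c * (f ?M + f ?U - (f I + f J))"
      by (simp add: distrib_left right_diff_distrib)
    also have "\<dots> \<le> 0"
      using f \<open>\<not> c > 0\<close> by (simp add: mult_nonpos_nonneg)
    finally show "g ?M + g ?U = g I + g J" using g by linarith
  qed
  with assms(3) show False by blast
qed

lemma same_ray_if_tight:
  assumes "f \<in> irreducibles n" "g \<in> irreducibles n"
    and "\<And>v. v \<in> tight n f \<Longrightarrow> pairing (Pow {1..n}) v g = 0"
  shows "(f, g) \<in> same_ray n"
proof -
  have fg: "irreducible_supermodular n f" "irreducible_supermodular n g"
    using assms by (auto simp: irreducibles_def)
  obtain c where c: "equivalent n g (\<lambda>I. c * f I)"
    using equivalent_if_tight[OF fg(1)] assms(3) by blast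
  then have "c > 0"
    using pos_multiple fg unfolding irreducible_supermodular_def by blast
  then show ?thesis
    using assms c by (auto simp: same_ray_def)
qed

text \<open>The tight functionals lie in the span of the \<open>2 ^ n\<close> coordinate vectors
  \<open>delta S\<close>, which bounds the size of a maximal independent subset.\<close>

lemma tight_basis:
  "\<exists>B \<subseteq> tight n f. card B \<le> 2 ^ n \<and> tight n f \<subseteq> fun_vs.span B"
proof -
  obtain B where B: "B \<subseteq> tight n f" "fun_vs.independent B" "tight n f \<subseteq> fun_vs.span B"
    using fun_vs.maximal_independent_subset by blast
  have "B \<subseteq> fun_vs.span (delta ` Pow {1..n})"
    using B(1) local_functionals_span by (auto simp: tight_def)
  then have "card B \<le> card ((delta ` Pow {1..n}) :: (nat set \<Rightarrow> real) set)"
    using fun_vs.independent_span_bound[of "delta ` Pow {1..n}" B] B(2) by simp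
  also have "\<dots> \<le> card (Pow {1..n})" by (rule card_image_le) simp
  finally show ?thesis using B by (auto simp: card_Pow)
qed

theorem theorem5p1:
  fixes n :: nat
  assumes "n \<ge> 1"
  shows "finite (irreducibles n // same_ray n) \<and>
         card (irreducibles n // same_ray n) \<le> (n ^ 2 * 2 ^ n) choose (2 ^ n)"
proof -
  \<comment> \<open>The basis is chosen for each \<open>f\<close> separately, so members of one ray
    may get different bases; the count only needs that equal bases force equal rays.\<close>
  obtain basis where basis: "\<And>f. basis f \<subseteq> tight n f" "\<And>f. card (basis f) \<le> 2 ^ n"
      "\<And>f. tight n f \<subseteq> fun_vs.span (basis f)"
    using tight_basis[of n] by metis
  let ?F = "{B. B \<subseteq> local_functionals n \<and> card B \<le> 2 ^ n}"
  have quot: "finite (irreducibles n // same_ray n) \<and>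
      card (irreducibles n // same_ray n) \<le> card ?F"
  proof (rule card_quotient_le[OF equiv_same_ray, where h = basis])
    show "finite ?F"
      by (rule finite_subset[of _ "Pow (local_functionals n)"]) (auto simp: finite_local_functionals)
    show "basis ` irreducibles n \<subseteq> ?F"
      using basis(1,2) by (auto simp: tight_def)
    fix f g assume fg: "f \<in> irreducibles n" "g \<in> irreducibles n" "basis f = basis g"
    show "(f, g) \<in> same_ray n"
    proof (rule same_ray_if_tight[OF fg(1,2)])
      fix v assume "v \<in> tight n f"
      then have "v \<in> fun_vs.span (basis g)" using basis(3)[of f] fg(3) by auto
      then show "pairing (Pow {1..n}) v g = 0"
        by (rule pairing_span_eq_0) (use basis(1)[of g] in \<open>auto simp: tight_def\<close>)
    qed
  qed
  note card_subsets_card_le[OF finite_local_functionals[of n], of "2 ^ n"]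
  also have "(card (local_functionals n) + 2 ^ n) choose (2 ^ n) \<le> (n ^ 2 * 2 ^ n) choose (2 ^ n)"
  proof (rule binomial_right_mono)
    \<comment> \<open>The two sides differ by \<open>(n - 1) * 2 ^ n\<close>, nonnegative since
      \<open>n\<close> is at least 1; the summand 1 accounts for the padding.\<close>
    have "(n * (n - 1) + 1) * 2 ^ n \<le> n ^ 2 * 2 ^ n"
      using assms by (intro mult_right_mono) (cases n; simp add: power2_eq_square)+
    then show "card (local_functionals n) + 2 ^ n \<le> n ^ 2 * 2 ^ n"
      using card_local_functionals[of n] by (simp only: add_mult_distrib mult_1)
  qed
  finally show ?thesis using quot by linarith
qed

end
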